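(* Let $k$ be a positive integer, let $A,B$ be non-zero real constants with $A\neq 1$, and let $(u_n)_{n\ge 0}$ be a solution of $$u_{n+4k}=\frac{u_n}{A+B\prod_{i=1}^{k}u_{n+4(i-1)}},\qquad n\ge 0.$$ Suppose the initial conditions $u_i$, $i=0,\dots,4k-1$, are such that $$\prod_{j=0}^{k-1}u_{4j+p}=\frac{1-A}{B},\qquad p=0,1,2,3.$$ Then the solution $(u_n)$ is periodic with period $4k$.
   Context: Periodic with period $4k$ means $u_{n+4k}=u_n$ for all $n\ge 0$ (minimality of the period is not asserted). *)

theory Defs
  imports Complex_Main
begin

end

theory Submission
  imports Defs
begin

text \<open>
  Write $P_n = \prod_{j<k} u_{n+4j}$ and $c = (1-A)/B$. The recurrence reads
  $u_{n+4k} = u_n / (A + B P_n)$, and $c$ is exactly the value of $P_n$ that makes the denominator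
  equal to $1$, so that $P_n = c$ gives $u_{n+4k} = u_n$. It remains to see that the value $c$
  propagates from $P_0, \dots, P_3$ to every $P_n$: passing from $P_n$ to $P_{n+4}$ exchanges the
  factor $u_n$ for $u_{n+4k}$ (lemma \<open>window_prod_shift\<close>), and by the above these two factors
  coincide; they may be cancelled since $c \neq 0$.
\<close>

text \<open>
  Both sides are the product of the $k+1$ terms $u_n, u_{n+d}, \dots, u_{n+dk}$, with the first
  or the last term split off.
\<close>

lemma window_prod_shift:
  fixes u :: "nat \<Rightarrow> 'a::comm_monoid_mult"
  shows "u n * (\<Prod>j<k. u (n + d + d * j)) = (\<Prod>j<k. u (n + d * j)) * u (n + d * k)"
proof -
  have "u n * (\<Prod>j<k. u (n + d + d * j)) = (\<Prod>j<Suc k. u (n + d * j))"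
    by (subst prod.lessThan_Suc_shift) (simp add: add.assoc)
  then show ?thesis
    by simp
qed

theorem theorem4p1:
  fixes k :: nat and A B :: real and u :: "nat \<Rightarrow> real"
  assumes "k > 0"
    and "A \<noteq> 0" and "B \<noteq> 0" and "A \<noteq> 1"
    and "\<forall>n. u (n + 4 * k) = u n / (A + B * (\<Prod>i = 1..k. u (n + 4 * (i - 1))))"
    and "\<forall>p \<in> {0, 1, 2, 3}. (\<Prod>j = 0..<k. u (4 * j + p)) = (1 - A) / B"
  shows "\<forall>n. u (n + 4 * k) = u n"
proof -
  define P where "P n = (\<Prod>j<k. u (n + 4 * j))" for n
  define c where "c = (1 - A) / B"
  have c_nz: "c \<noteq> 0" and denom: "A + B * c = 1"
    using \<open>B \<noteq> 0\<close> \<open>A \<noteq> 1\<close> by (simp_all add: c_def)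
  have rec: "u (n + 4 * k) = u n / (A + B * P n)" for n
    using assms(5) by (simp add: P_def prod.atLeast1_atMost_eq)
  have period: "u (n + 4 * k) = u n" if "P n = c" for n
    using rec[of n] that denom by simp
  have init: "P p = c" if "p < 4" for p
  proof -
    have "p \<in> {0, 1, 2, 3}"
      using that by auto
    then have "(\<Prod>j = 0..<k. u (4 * j + p)) = c"
      using assms(6) unfolding c_def by blast
    then show ?thesis
      by (simp add: P_def add.commute atLeast0LessThan)
  qed
  have step: "P (n + 4) = c" if Pn: "P n = c" for n
  proof -
    have "P n \<noteq> 0"
      using Pn c_nz by simp
    \<comment> \<open>the factor with index $0$ of $P_n$; it exists because $k > 0$\<close>
    then have "u n \<noteq> 0"
      using \<open>k > 0\<close> by (force simp: P_def)
    moreover have "u n * P (n + 4) = P n * u (n + 4 * k)"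
      unfolding P_def by (rule window_prod_shift)
    ultimately show ?thesis
      using Pn period[OF Pn] by simp
  qed
  have "P n = c" for n
  proof (induction n rule: less_induct)
    case (less n)
    show ?case
    proof (cases "n < 4")
      case True
      then show ?thesis by (rule init)
    next
      case False
      then show ?thesis
        using step[of "n - 4"] less.IH[of "n - 4"] by simp
    qed
  qed
  then show ?thesis
    using period by blast
qed

end
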